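(* Let $\Gamma$ be a finite group with a symmetric generating set $S$, and let $t>0$. For the continuous-time random walk on the Cayley graph of $(\Gamma,S)$ started at the identity with positive rates $(r_s)_{s\in S}$, $r_s=r_{s^{-1}}$, increasing any of the rates always decreases the $\ell^\infty$-distance and the $\ell^2$-distance of the law of the walk at time $t$ to the uniform distribution on $\Gamma$.
   Context: The random walk is the continuous-time Markov chain on $\Gamma$ that jumps from $x$ to $xs$ at rate $r_s$ for each $s\in S$. Symmetric means $s\in S\Rightarrow s^{-1}\in S$; since $r_s=r_{s^{-1}}$ is always assumed, increasing a rate $r_s$ means increasing $r_s$ and $r_{s^{-1}}$ equally. For distributions $f,g$ on $\Gamma$, $\ell^2(f,g)=\bigl(\sum_v|f(v)-g(v)|^2\bigr)^{1/2}$ and $\ell^\infty(f,g)=\max_v|f(v)-g(v)|$. "Decreases" is meant in the weak sense (the distance for the larger rates is at most the distance for the smaller rates). *)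

theory Defs
  imports "HOL-Probability.Probability" "HOL-Algebra.Generated_Groups"
begin

definition symmetric_generating_set :: "('a, 'b) monoid_scheme \<Rightarrow> 'a set \<Rightarrow> bool" where
  "symmetric_generating_set G S \<longleftrightarrow>
     S \<subseteq> carrier G \<and> (\<forall>s\<in>S. inv\<^bsub>G\<^esub> s \<in> S) \<and> generate G S = carrier G"

definition symmetric_rates :: "('a, 'b) monoid_scheme \<Rightarrow> 'a set \<Rightarrow> ('a \<Rightarrow> real) \<Rightarrow> bool" where
  "symmetric_rates G S r \<longleftrightarrow> (\<forall>s\<in>S. 0 < r s \<and> r s = r (inv\<^bsub>G\<^esub> s))"

definition transition_function :: "'a set \<Rightarrow> (real \<Rightarrow> 'a \<Rightarrow> 'a \<Rightarrow> real) \<Rightarrow> bool" where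
  "transition_function V K \<longleftrightarrow>
     (\<forall>t\<ge>0. \<forall>x\<in>V. (\<forall>y\<in>V. 0 \<le> K t x y) \<and> (\<Sum>y\<in>V. K t x y) = 1) \<and>
     (\<forall>x\<in>V. \<forall>y\<in>V. K 0 x y = of_bool (x = y)) \<and>
     (\<forall>s\<ge>0. \<forall>t\<ge>0. \<forall>x\<in>V. \<forall>y\<in>V. K (s + t) x y = (\<Sum>z\<in>V. K s x z * K t z y))"

text \<open>The matrix \<open>Q\<close> is the derivative of the transition function at time 0: for \<open>x \<noteq> y\<close>,
  a jump from \<open>x\<close> to \<open>y\<close> within time \<open>h\<close> has probability \<open>Q x y * h + o(h)\<close>.\<close>

definition has_generator ::
  "'a set \<Rightarrow> (real \<Rightarrow> 'a \<Rightarrow> 'a \<Rightarrow> real) \<Rightarrow> ('a \<Rightarrow> 'a \<Rightarrow> real) \<Rightarrow> bool" where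
  "has_generator V K Q \<longleftrightarrow>
     (\<forall>x\<in>V. \<forall>y\<in>V. ((\<lambda>h. (K h x y - of_bool (x = y)) / h) \<longlongrightarrow> Q x y) (at_right 0))"

text \<open>A continuous-time Markov chain on a finite state space \<open>V\<close> with generator \<open>Q\<close>, started at
  \<open>x0\<close>: a process with right-continuous (piecewise constant) paths whose conditional law, given
  its values at finitely many earlier times, depends on the last of these values only and is given
  by a transition function with generator \<open>Q\<close>. The Markov property is multiplied out, so that
  conditioning on a null event imposes nothing.\<close>

definition ctmc ::
  "'a set \<Rightarrow> ('a \<Rightarrow> 'a \<Rightarrow> real) \<Rightarrow> 'a \<Rightarrow> 'w measure \<Rightarrow> (real \<Rightarrow> 'w \<Rightarrow> 'a) \<Rightarrow> bool" where
  "ctmc V Q x0 M X \<longleftrightarrow>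
     prob_space M \<and>
     (\<forall>t\<ge>0. X t \<in> measurable M (count_space V)) \<and>
     (AE \<omega> in M. X 0 \<omega> = x0) \<and>
     (AE \<omega> in M. \<forall>t\<ge>0. \<forall>\<^sub>F u in at_right t. X u \<omega> = X t \<omega>) \<and>
     (\<exists>K. transition_function V K \<and> has_generator V K Q \<and>
       (\<forall>(n::nat) (t :: nat \<Rightarrow> real) (x :: nat \<Rightarrow> 'a).
          0 \<le> t 0 \<longrightarrow> (\<forall>i\<le>n. t i < t (Suc i)) \<longrightarrow> (\<forall>i\<le>Suc n. x i \<in> V) \<longrightarrow>
          measure M {\<omega> \<in> space M. \<forall>i\<le>Suc n. X (t i) \<omega> = x i} =
          measure M {\<omega> \<in> space M. \<forall>i\<le>n. X (t i) \<omega> = x i} *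
            K (t (Suc n) - t n) (x n) (x (Suc n))))"

text \<open>Jumps from \<open>x\<close> to \<open>x s\<close> at rate \<open>r s\<close>, with the diagonal making rows sum to 0. If the
  identity is in \<open>S\<close>, its summand vanishes.\<close>

definition walk_generator ::
  "('a, 'b) monoid_scheme \<Rightarrow> 'a set \<Rightarrow> ('a \<Rightarrow> real) \<Rightarrow> 'a \<Rightarrow> 'a \<Rightarrow> real" where
  "walk_generator G S r x y =
     (\<Sum>s\<in>S. r s * (of_bool (y = x \<otimes>\<^bsub>G\<^esub> s) - of_bool (y = x)))"

definition random_walk ::
  "('a, 'b) monoid_scheme \<Rightarrow> 'a set \<Rightarrow> ('a \<Rightarrow> real) \<Rightarrow> 'w measure \<Rightarrow> (real \<Rightarrow> 'w \<Rightarrow> 'a) \<Rightarrow> bool" where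
  "random_walk G S r M X \<longleftrightarrow> ctmc (carrier G) (walk_generator G S r) \<one>\<^bsub>G\<^esub> M X"

definition law :: "'a set \<Rightarrow> 'w measure \<Rightarrow> ('w \<Rightarrow> 'a) \<Rightarrow> 'a \<Rightarrow> real" where
  "law V M Z v = measure (distr M (count_space V) Z) {v}"

definition l2_dist :: "'a set \<Rightarrow> ('a \<Rightarrow> real) \<Rightarrow> ('a \<Rightarrow> real) \<Rightarrow> real" where
  "l2_dist V f g = sqrt (\<Sum>v\<in>V. \<bar>f v - g v\<bar>\<^sup>2)"

definition linf_dist :: "'a set \<Rightarrow> ('a \<Rightarrow> real) \<Rightarrow> ('a \<Rightarrow> real) \<Rightarrow> real" where
  "linf_dist V f g = Max ((\<lambda>v. \<bar>f v - g v\<bar>) ` V)"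

end

theory Submission
  imports Defs "HOL-Real_Asymp.Real_Asymp"
begin

text \<open>Let \<open>K\<close> and \<open>K'\<close> be the transition functions for the rates \<open>r \<le> r'\<close>. They are symmetric and
  left-invariant, so with \<open>n = |\<Gamma>|\<close> the sup-distance to uniform is attained at the identity and
  equals \<open>tr K\<^sub>t / n - 1 / n\<close>, while the squared \<open>\<ell>\<^sup>2\<close>-distance equals \<open>tr K\<^sub>2\<^sub>t / n - 1 / n\<close>. It
  remains to see that \<open>tr K'\<^sub>t \<le> tr K\<^sub>t\<close>. As the generators differ by a Dirichlet form,
  \<open>e\<^sup>\<epsilon>\<^sup>h K\<^sub>h - K'\<^sub>h\<close> is positive semidefinite for small \<open>h\<close>. For symmetric semigroups \<open>P, R\<close> the
  function \<open>c(u) = tr (P\<^sub>u R\<^sub>t\<^sub>-\<^sub>u)\<close> satisfies \<open>c(u)\<^sup>2 \<le> c(2u) tr R\<^sub>t\<close> by Cauchy--Schwarz, so that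
  \<open>tr R\<^sub>t \<le> c(u)\<close> at \<open>u = t / 2\<^sup>k\<close>, which is positivity of a trace, propagates to
  \<open>tr R\<^sub>t \<le> c(t) = tr P\<^sub>t\<close>.\<close>

section \<open>Trace comparison of symmetric semigroups\<close>

text \<open>Stochasticity is left out so that a transition function rescaled by
  \<open>exp (\<epsilon> * s)\<close> qualifies as well; such rescaled semigroups enter the
  comparison of generators below.\<close>

definition symmetric_semigroup :: "'a set \<Rightarrow> (real \<Rightarrow> 'a \<Rightarrow> 'a \<Rightarrow> real) \<Rightarrow> bool" where
  "symmetric_semigroup V P \<longleftrightarrow>
     (\<forall>t\<ge>0. \<forall>x\<in>V. \<forall>y\<in>V. P t x y = P t y x) \<and>
     (\<forall>s\<ge>0. \<forall>t\<ge>0. \<forall>x\<in>V. \<forall>y\<in>V. P (s + t) x y = (\<Sum>z\<in>V. P s x z * P t z y))"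

lemma symmetric_semigroup_sym:
  "symmetric_semigroup V P \<Longrightarrow> 0 \<le> t \<Longrightarrow> x \<in> V \<Longrightarrow> y \<in> V \<Longrightarrow> P t x y = P t y x"
  unfolding symmetric_semigroup_def by blast

lemma symmetric_semigroup_add:
  "symmetric_semigroup V P \<Longrightarrow> 0 \<le> s \<Longrightarrow> 0 \<le> t \<Longrightarrow> x \<in> V \<Longrightarrow> y \<in> V \<Longrightarrow>
    P (s + t) x y = (\<Sum>z\<in>V. P s x z * P t z y)"
  unfolding symmetric_semigroup_def by blast

lemma symmetric_semigroup_square:
  assumes "symmetric_semigroup V P" "0 \<le> t" "x \<in> V" "y \<in> V"
  shows "P (2 * t) x y = (\<Sum>z\<in>V. P t z x * P t z y)"
  using symmetric_semigroup_add[OF assms(1,2,2,3,4)] symmetric_semigroup_sym[OF assms(1,2,3)]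
  by simp

definition trace_product :: "'a set \<Rightarrow> ('a \<Rightarrow> 'a \<Rightarrow> real) \<Rightarrow> ('a \<Rightarrow> 'a \<Rightarrow> real) \<Rightarrow> real" where
  "trace_product V A B = (\<Sum>x\<in>V. \<Sum>y\<in>V. A x y * B y x)"

lemma trace_product_Cauchy_Schwarz:
  "(trace_product V A B)\<^sup>2 \<le> (\<Sum>x\<in>V. \<Sum>y\<in>V. (A x y)\<^sup>2) * (\<Sum>x\<in>V. \<Sum>y\<in>V. (B x y)\<^sup>2)"
proof -
  have "(\<Sum>p\<in>V \<times> V. A (fst p) (snd p) * B (snd p) (fst p))\<^sup>2
      \<le> (\<Sum>p\<in>V \<times> V. (A (fst p) (snd p))\<^sup>2) * (\<Sum>p\<in>V \<times> V. (B (snd p) (fst p))\<^sup>2)"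
    by (rule Cauchy_Schwarz_ineq_sum)
  moreover have "(\<Sum>x\<in>V. \<Sum>y\<in>V. (B x y)\<^sup>2) = (\<Sum>x\<in>V. \<Sum>y\<in>V. (B y x)\<^sup>2)"
    by (rule sum.swap)
  ultimately show ?thesis
    by (simp add: trace_product_def sum.cartesian_product case_prod_unfold)
qed

lemma sum_square_semigroup:
  assumes "symmetric_semigroup V R" "0 \<le> t"
  shows "(\<Sum>x\<in>V. \<Sum>y\<in>V. (R t x y)\<^sup>2) = (\<Sum>x\<in>V. R (2 * t) x x)"
proof -
  have "(\<Sum>x\<in>V. \<Sum>y\<in>V. (R t x y)\<^sup>2) = (\<Sum>y\<in>V. \<Sum>x\<in>V. (R t x y)\<^sup>2)"
    by (rule sum.swap)
  also have "\<dots> = (\<Sum>x\<in>V. R (2 * t) x x)"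
    using symmetric_semigroup_square[OF assms]
    by (intro sum.cong) (simp_all add: power2_eq_square)
  finally show ?thesis .
qed

text \<open>Write R_(t-u) = R_v R_(t/2) with v = t/2 - u, which is nonnegative as 2u <= t.
  Cauchy-Schwarz for the Hilbert-Schmidt pairing of P_u R_v with R_(t/2) gives the bound: by
  symmetry and cyclicity of the trace, the squared norms of the two factors are tr (P_2u R_2v) and
  tr R_t, and 2v = t - 2u.\<close>

lemma trace_product_doubling:
  assumes P: "symmetric_semigroup V P" and R: "symmetric_semigroup V R"
    and u: "0 \<le> u" "2 * u \<le> t"
  shows "(trace_product V (P u) (R (t - u)))\<^sup>2
    \<le> trace_product V (P (2 * u)) (R (t - 2 * u)) * (\<Sum>x\<in>V. R t x x)"
proof -
  define v where "v = t / 2 - u"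
  define W where "W x z = (\<Sum>y\<in>V. P u x y * R v y z)" for x z
  have v: "0 \<le> v" "t - u = v + t / 2" "t - 2 * u = 2 * v" and t: "0 \<le> t / 2"
    using u by (simp_all add: v_def)
  have "trace_product V (P u) (R (t - u))
      = (\<Sum>x\<in>V. \<Sum>y\<in>V. \<Sum>z\<in>V. P u x y * R v y z * R (t / 2) z x)"
    unfolding trace_product_def v(2)
    using symmetric_semigroup_add[OF R v(1) t]
    by (intro sum.cong) (simp_all add: sum_distrib_left mult.assoc)
  also have "\<dots> = (\<Sum>x\<in>V. \<Sum>z\<in>V. \<Sum>y\<in>V. P u x y * R v y z * R (t / 2) z x)"
    by (intro sum.cong refl sum.swap)
  also have "\<dots> = trace_product V W (R (t / 2))"
    by (simp add: trace_product_def W_def sum_distrib_right)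
  finally have *: "trace_product V (P u) (R (t - u)) = trace_product V W (R (t / 2))" .
  \<comment> \<open>The square is expanded into a fourfold sum. The swaps bring \<open>x\<close> and
    \<open>z\<close> innermost, where the sum factors into an entry of P_u P_u and an entry of R_v
    R_v.\<close>
  have "(\<Sum>x\<in>V. \<Sum>z\<in>V. (W x z)\<^sup>2)
      = (\<Sum>x\<in>V. \<Sum>z\<in>V. \<Sum>y\<in>V. \<Sum>y'\<in>V. P u x y * R v y z * (P u x y' * R v y' z))"
    by (simp add: W_def power2_eq_square sum_product)
  also have "\<dots> = (\<Sum>x\<in>V. \<Sum>y\<in>V. \<Sum>z\<in>V. \<Sum>y'\<in>V. P u x y * R v y z * (P u x y' * R v y' z))"
    by (intro sum.cong refl sum.swap)
  also have "\<dots> = (\<Sum>x\<in>V. \<Sum>y\<in>V. \<Sum>y'\<in>V. \<Sum>z\<in>V. P u x y * R v y z * (P u x y' * R v y' z))"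
    by (intro sum.cong refl sum.swap)
  also have "\<dots> = (\<Sum>y\<in>V. \<Sum>x\<in>V. \<Sum>y'\<in>V. \<Sum>z\<in>V. P u x y * R v y z * (P u x y' * R v y' z))"
    by (rule sum.swap)
  also have "\<dots> = (\<Sum>y\<in>V. \<Sum>y'\<in>V. \<Sum>x\<in>V. \<Sum>z\<in>V. P u x y * R v y z * (P u x y' * R v y' z))"
    by (intro sum.cong refl sum.swap)
  also have "\<dots> = (\<Sum>y\<in>V. \<Sum>y'\<in>V. (\<Sum>x\<in>V. P u x y * P u x y') * (\<Sum>z\<in>V. R v y' z * R v z y))"
    using symmetric_semigroup_sym[OF R v(1)]
    by (intro sum.cong refl) (simp add: sum_product ac_simps)
  also have "\<dots> = trace_product V (P (2 * u)) (R (2 * v))"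
    unfolding trace_product_def
    using symmetric_semigroup_square[OF P u(1)] symmetric_semigroup_add[OF R v(1) v(1)]
    by (intro sum.cong refl) simp
  finally have W: "(\<Sum>x\<in>V. \<Sum>z\<in>V. (W x z)\<^sup>2) = trace_product V (P (2 * u)) (R (t - 2 * u))"
    by (simp add: v)
  show ?thesis
    using trace_product_Cauchy_Schwarz[of V W "R (t / 2)"]
    unfolding * W sum_square_semigroup[OF R t] by simp
qed

text \<open>The form order is assumed at small times only, where it can be read off from generators.
  It need not persist to time \<open>t\<close>, since the exponential is not operator monotone; the
  trace inequality does, by repeated doubling.\<close>

lemma trace_mono_semigroup:
  assumes P: "symmetric_semigroup V P" and R: "symmetric_semigroup V R"
    and fin: "finite V" and R0: "\<And>x y. x \<in> V \<Longrightarrow> y \<in> V \<Longrightarrow> R 0 x y = of_bool (x = y)"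
    and t: "0 < t"
    and psd: "\<forall>\<^sub>F h in at_right 0. \<forall>f. 0 \<le> (\<Sum>x\<in>V. \<Sum>y\<in>V. (P h x y - R h x y) * (f x * f y))"
  shows "(\<Sum>x\<in>V. R t x x) \<le> (\<Sum>x\<in>V. P t x x)"
proof (cases "(\<Sum>x\<in>V. R t x x) > 0")
  case False
  \<comment> \<open>The trace of P_t is a sum of squares, which settles this case. The other case
    supplies the positive \<open>b\<close> that the induction cancels.\<close>
  have "0 \<le> (\<Sum>x\<in>V. \<Sum>y\<in>V. (P (t / 2) x y)\<^sup>2)"
    by (intro sum_nonneg) simp
  then show ?thesis
    using False sum_square_semigroup[OF P, of "t / 2"] t by simp
next
  case True
  define b where "b = (\<Sum>x\<in>V. R t x x)"
  define c where "c u = trace_product V (P u) (R (t - u))" for u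
  have b: "b > 0" using True by (simp add: b_def)
  \<comment> \<open>A small time of the form t / 2^k is chosen, so that \<open>k\<close> doublings
    end exactly at \<open>t\<close>.\<close>
  have "filterlim (\<lambda>k. t * (1 / 2) ^ k) (at_right 0) sequentially"
    using t by real_asymp
  from filterlim_iff[THEN iffD1, rule_format, OF this psd]
  obtain k :: nat where k: "\<And>f. 0 \<le> (\<Sum>x\<in>V. \<Sum>y\<in>V.
      (P (t * (1 / 2) ^ k) x y - R (t * (1 / 2) ^ k) x y) * (f x * f y))"
    by (auto simp: eventually_sequentially)
  define h where "h = t * (1 / 2) ^ k"
  have h: "0 < h" "h \<le> t" "2 ^ k * h = t"
    using t by (auto simp: h_def power_divide divide_le_eq)
  define w where "w = (t - h) / 2"
  have w: "0 \<le> w" "t - h = 2 * w" "t = h + 2 * w"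
    using h by (simp_all add: w_def field_simps)
  have "b = trace_product V (R h) (R (2 * w))"
    unfolding b_def trace_product_def using symmetric_semigroup_add[OF R, of h "2 * w"] h(1) w
    by simp
  \<comment> \<open>Positivity of a trace: R_2w is the product of the transpose of R_w with R_w, so
    the trace against it is the sum over \<open>z\<close> of the quadratic form of P_h - R_h at the
    row \<open>R w z\<close>.\<close>
  then have "c h - b = (\<Sum>x\<in>V. \<Sum>y\<in>V. (P h x y - R h x y) * R (2 * w) y x)"
    by (simp add: c_def w(2) trace_product_def sum_subtractf left_diff_distrib)
  also have "\<dots> = (\<Sum>x\<in>V. \<Sum>y\<in>V. \<Sum>z\<in>V. (P h x y - R h x y) * (R w z x * R w z y))"
    using symmetric_semigroup_square[OF R w(1)]
    by (intro sum.cong refl) (simp add: sum_distrib_left mult.commute)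
  also have "\<dots> = (\<Sum>x\<in>V. \<Sum>z\<in>V. \<Sum>y\<in>V. (P h x y - R h x y) * (R w z x * R w z y))"
    by (intro sum.cong refl sum.swap)
  also have "\<dots> = (\<Sum>z\<in>V. \<Sum>x\<in>V. \<Sum>y\<in>V. (P h x y - R h x y) * (R w z x * R w z y))"
    by (rule sum.swap)
  also have "\<dots> \<ge> 0"
    unfolding h_def by (intro sum_nonneg[of V] k)
  finally have start: "b \<le> c h" by simp
  have "b \<le> c (2 ^ i * h)" if "i \<le> k" for i
    using that
  proof (induction i)
    case 0
    then show ?case using start by simp
  next
    case (Suc i)
    have "2 ^ Suc i * h \<le> 2 ^ k * h"
      using Suc.prems h(1) by (intro mult_right_mono power_increasing) auto
    then have "(c (2 ^ i * h))\<^sup>2 \<le> c (2 ^ Suc i * h) * b"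
      using trace_product_doubling[OF P R, of "2 ^ i * h" t] h
      by (simp add: c_def b_def mult.assoc)
    moreover have "b * b \<le> (c (2 ^ i * h))\<^sup>2"
      using Suc b by (simp add: power2_eq_square mult_mono)
    \<comment> \<open>Together b * b <= c(2u) * b with u = 2^i h, and \<open>b\<close>
      cancels.\<close>
    ultimately show ?case
      using b by (meson mult_right_le_imp_le order_trans)
  qed
  from this[of k] have "b \<le> c t"
    using h(3) by simp
  \<comment> \<open>At u = t the second factor is R_0, the identity matrix.\<close>
  also have "c t = (\<Sum>x\<in>V. \<Sum>y\<in>V. if y = x then P t x y else 0)"
    unfolding c_def trace_product_def using R0 by (intro sum.cong refl) simp
  also have "\<dots> = (\<Sum>x\<in>V. P t x x)"
    using fin by simp
  finally show ?thesis
    by (simp add: b_def)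
qed

section \<open>Transition functions with a symmetric generator\<close>

lemma transition_functionD:
  assumes "transition_function V K"
  shows transition_nonneg: "0 \<le> t \<Longrightarrow> x \<in> V \<Longrightarrow> y \<in> V \<Longrightarrow> 0 \<le> K t x y"
    and transition_sum: "0 \<le> t \<Longrightarrow> x \<in> V \<Longrightarrow> (\<Sum>y\<in>V. K t x y) = 1"
    and transition_zero: "x \<in> V \<Longrightarrow> y \<in> V \<Longrightarrow> K 0 x y = of_bool (x = y)"
    and transition_add: "0 \<le> s \<Longrightarrow> 0 \<le> t \<Longrightarrow> x \<in> V \<Longrightarrow> y \<in> V \<Longrightarrow>
      K (s + t) x y = (\<Sum>z\<in>V. K s x z * K t z y)"
  using assms unfolding transition_function_def by blast+

lemma transition_double:
  assumes "transition_function V K" "0 \<le> s" "x \<in> V" "y \<in> V"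
  shows "K (2 * s) x y = (\<Sum>z\<in>V. K s x z * K s z y)"
  unfolding mult_2 by (rule transition_add[OF assms(1,2,2,3,4)])

text \<open>Pairing a row-stochastic with a column-stochastic semigroup makes the entrywise maximum of
  \<open>A\<^sub>s - B\<^sub>s\<close> at most double when \<open>s\<close> doubles, so no operator norm is needed; the transpose of a
  transition function is only known to be column-stochastic.\<close>

lemma semigroup_eqI:
  fixes A B :: "real \<Rightarrow> 'a \<Rightarrow> 'a \<Rightarrow> real"
  assumes fin: "finite V"
    and A0: "\<And>s x y. 0 \<le> s \<Longrightarrow> x \<in> V \<Longrightarrow> y \<in> V \<Longrightarrow> 0 \<le> A s x y"
    and A1: "\<And>s x. 0 \<le> s \<Longrightarrow> x \<in> V \<Longrightarrow> (\<Sum>y\<in>V. A s x y) = 1"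
    and A2: "\<And>s x y. 0 \<le> s \<Longrightarrow> x \<in> V \<Longrightarrow> y \<in> V \<Longrightarrow> A (2 * s) x y = (\<Sum>z\<in>V. A s x z * A s z y)"
    and B0: "\<And>s x y. 0 \<le> s \<Longrightarrow> x \<in> V \<Longrightarrow> y \<in> V \<Longrightarrow> 0 \<le> B s x y"
    and B1: "\<And>s y. 0 \<le> s \<Longrightarrow> y \<in> V \<Longrightarrow> (\<Sum>x\<in>V. B s x y) = 1"
    and B2: "\<And>s x y. 0 \<le> s \<Longrightarrow> x \<in> V \<Longrightarrow> y \<in> V \<Longrightarrow> B (2 * s) x y = (\<Sum>z\<in>V. B s x z * B s z y)"
    and QA: "has_generator V A Q" and QB: "has_generator V B Q"
    and t: "0 < t" and xy: "x \<in> V" "y \<in> V"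
  shows "A t x y = B t x y"
proof -
  have doubling: "\<bar>A (2 * s) x y - B (2 * s) x y\<bar> \<le> 2 * c"
    if s: "0 \<le> s" and c: "\<And>x y. x \<in> V \<Longrightarrow> y \<in> V \<Longrightarrow> \<bar>A s x y - B s x y\<bar> \<le> c"
      and xy: "x \<in> V" "y \<in> V" for s c x y
  proof -
    \<comment> \<open>The splitting A A - B B = A (A - B) + (A - B) B leaves a row sum of A in the
      first term and a column sum of B in the second; both are 1.\<close>
    have "A (2 * s) x y - B (2 * s) x y
        = (\<Sum>z\<in>V. A s x z * (A s z y - B s z y) + (A s x z - B s x z) * B s z y)"
      using A2[OF s xy] B2[OF s xy] by (simp add: sum_subtractf[symmetric] algebra_simps)
    also have "\<bar>\<dots>\<bar> \<le> (\<Sum>z\<in>V. A s x z * c + c * B s z y)"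
    proof (intro order_trans[OF sum_abs] sum_mono)
      fix z assume z: "z \<in> V"
      have "\<bar>A s x z * (A s z y - B s z y)\<bar> \<le> A s x z * c"
        using A0[OF s xy(1) z] c[OF z xy(2)] by (simp add: abs_mult mult_left_mono)
      moreover have "\<bar>(A s x z - B s x z) * B s z y\<bar> \<le> c * B s z y"
        using B0[OF s z xy(2)] c[OF xy(1) z] by (simp add: abs_mult mult_right_mono)
      ultimately show "\<bar>A s x z * (A s z y - B s z y) + (A s x z - B s x z) * B s z y\<bar>
          \<le> A s x z * c + c * B s z y"
        by linarith
    qed
    also have "\<dots> = 2 * c"
      using A1[OF s xy(1)] B1[OF s xy(2)]
      by (simp add: sum.distrib sum_distrib_left[symmetric] sum_distrib_right[symmetric])
    finally show ?thesis .
  qed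
  \<comment> \<open>Equal generators make the entries differ by o(h). At some h = t / 2^k the
    difference is at most (e / t) h, and \<open>k\<close> doublings turn this into (e / t) 2^k h =
    e.\<close>
  have "\<bar>A t x y - B t x y\<bar> \<le> e" if e: "0 < e" for e
  proof -
    have "((\<lambda>h. (A h u v - B h u v) / h) \<longlongrightarrow> 0) (at_right 0)" if "u \<in> V" "v \<in> V" for u v
    proof -
      have "((\<lambda>h. (A h u v - of_bool (u = v)) / h - (B h u v - of_bool (u = v)) / h)
          \<longlongrightarrow> Q u v - Q u v) (at_right 0)"
        using QA QB that unfolding has_generator_def by (intro tendsto_diff) auto
      then show ?thesis
        by (simp add: diff_divide_distrib)
    qed
    then have "\<forall>\<^sub>F h in at_right 0. \<bar>(A h u v - B h u v) / h\<bar> < e / t" if "u \<in> V" "v \<in> V" for u v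
      using e t that by (fastforce dest: tendstoD[where e = "e / t"])
    then have "\<forall>\<^sub>F h in at_right 0. \<forall>u\<in>V. \<forall>v\<in>V. \<bar>(A h u v - B h u v) / h\<bar> < e / t"
      using fin by (simp add: eventually_ball_finite)
    moreover have "filterlim (\<lambda>k. t * (1 / 2) ^ k) (at_right 0) sequentially"
      using t by real_asymp
    ultimately have "\<forall>\<^sub>F k in sequentially. \<forall>u\<in>V. \<forall>v\<in>V.
        \<bar>(A (t * (1 / 2) ^ k) u v - B (t * (1 / 2) ^ k) u v) / (t * (1 / 2) ^ k)\<bar> < e / t"
      by (rule eventually_compose_filterlim)
    then obtain k :: nat where k: "\<And>u v. u \<in> V \<Longrightarrow> v \<in> V \<Longrightarrow>
        \<bar>(A (t * (1 / 2) ^ k) u v - B (t * (1 / 2) ^ k) u v) / (t * (1 / 2) ^ k)\<bar> < e / t"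
      by (auto simp: eventually_sequentially)
    define h where "h = t * (1 / 2) ^ k"
    have h: "0 < h" "2 ^ k * h = t"
      using t by (auto simp: h_def power_divide)
    have "\<bar>A h u v - B h u v\<bar> \<le> e / t * h" if "u \<in> V" "v \<in> V" for u v
      using k[OF that] h(1) t unfolding h_def[symmetric] by (simp add: abs_divide divide_simps mult_ac)
    then have "\<bar>A (2 ^ i * h) u v - B (2 ^ i * h) u v\<bar> \<le> 2 ^ i * (e / t * h)"
      if "u \<in> V" "v \<in> V" for i u v
      using that
    proof (induction i arbitrary: u v)
      case (Suc i)
      then show ?case
        using doubling[of "2 ^ i * h" "2 ^ i * (e / t * h)" u v] h(1) by (simp add: mult.assoc)
    qed simp
    from this[OF xy, of k] have "\<bar>A t x y - B t x y\<bar> \<le> e / t * (2 ^ k * h)"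
      using h(2) by (simp add: mult_ac)
    then show ?thesis
      using h(2) t by simp
  qed
  then have "\<bar>A t x y - B t x y\<bar> \<le> 0"
    by (rule field_le_epsilon) simp
  then show ?thesis by simp
qed

text \<open>The transpose of \<open>K\<close> is column-stochastic and has the transpose of
  \<open>Q\<close>, that is \<open>Q\<close> itself, as generator. So \<open>semigroup_eqI\<close>
  identifies it with \<open>K\<close> at positive times.\<close>

lemma transition_symmetric:
  assumes fin: "finite V" and K: "transition_function V K" and Q: "has_generator V K Q"
    and sym: "\<And>x y. x \<in> V \<Longrightarrow> y \<in> V \<Longrightarrow> Q x y = Q y x"
    and t: "0 \<le> t" and xy: "x \<in> V" "y \<in> V"
  shows "K t x y = K t y x"
proof (cases "t = 0")
  case True
  then show ?thesis using transition_zero[OF K] xy by auto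
next
  case False
  have "has_generator V (\<lambda>t x y. K t y x) Q"
    unfolding has_generator_def
  proof (intro ballI)
    fix x y assume xy: "x \<in> V" "y \<in> V"
    then have "((\<lambda>h. (K h y x - of_bool (y = x)) / h) \<longlongrightarrow> Q y x) (at_right 0)"
      using Q unfolding has_generator_def by blast
    then show "((\<lambda>h. (K h y x - of_bool (x = y)) / h) \<longlongrightarrow> Q x y) (at_right 0)"
      using sym[OF xy] by (simp add: eq_commute)
  qed
  then show ?thesis
    using False t xy fin Q transition_nonneg[OF K] transition_sum[OF K] transition_double[OF K]
    by (intro semigroup_eqI[where A = K and B = "\<lambda>t x y. K t y x" and V = V and Q = Q])
      (simp_all add: mult.commute)
qed

text \<open>Relabelling the states by \<open>\<pi>\<close> gives a semigroup with the same
  generator, so uniqueness applies. Symmetry of \<open>Q\<close> provides the column sums that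
  \<open>semigroup_eqI\<close> asks of its second semigroup.\<close>

lemma transition_invariant:
  assumes fin: "finite V" and K: "transition_function V K" and Q: "has_generator V K Q"
    and sym: "\<And>x y. x \<in> V \<Longrightarrow> y \<in> V \<Longrightarrow> Q x y = Q y x"
    and \<pi>: "bij_betw \<pi> V V" and inv: "\<And>x y. x \<in> V \<Longrightarrow> y \<in> V \<Longrightarrow> Q (\<pi> x) (\<pi> y) = Q x y"
    and t: "0 < t" and xy: "x \<in> V" "y \<in> V"
  shows "K t x y = K t (\<pi> x) (\<pi> y)"
proof -
  have \<pi>V: "\<pi> z \<in> V" if "z \<in> V" for z
    using \<pi> that by (auto simp: bij_betw_def)
  have \<pi>eq: "\<pi> u = \<pi> v \<longleftrightarrow> u = v" if "u \<in> V" "v \<in> V" for u v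
    using \<pi> that by (auto simp: bij_betw_def inj_on_def)
  have gen: "has_generator V (\<lambda>t x y. K t (\<pi> x) (\<pi> y)) Q"
    unfolding has_generator_def
  proof (intro ballI)
    fix x y assume xy: "x \<in> V" "y \<in> V"
    then have "((\<lambda>h. (K h (\<pi> x) (\<pi> y) - of_bool (\<pi> x = \<pi> y)) / h) \<longlongrightarrow> Q (\<pi> x) (\<pi> y)) (at_right 0)"
      using Q \<pi>V unfolding has_generator_def by blast
    then show "((\<lambda>h. (K h (\<pi> x) (\<pi> y) - of_bool (x = y)) / h) \<longlongrightarrow> Q x y) (at_right 0)"
      using inv[OF xy] \<pi>eq[OF xy] by simp
  qed
  have col: "(\<Sum>x\<in>V. K s (\<pi> x) (\<pi> y)) = 1" if s: "0 \<le> s" "y \<in> V" for s y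
  proof -
    have "(\<Sum>x\<in>V. K s (\<pi> x) (\<pi> y)) = (\<Sum>x\<in>V. K s x (\<pi> y))"
      by (rule sum.reindex_bij_betw[OF \<pi>])
    also have "\<dots> = (\<Sum>x\<in>V. K s (\<pi> y) x)"
      using transition_symmetric[OF fin K Q sym s(1)] \<pi>V s(2) by (intro sum.cong refl) blast
    finally show ?thesis
      using transition_sum[OF K s(1)] \<pi>V s(2) by simp
  qed
  have add: "K (2 * s) (\<pi> x) (\<pi> y) = (\<Sum>z\<in>V. K s (\<pi> x) (\<pi> z) * K s (\<pi> z) (\<pi> y))"
    if "0 \<le> s" "x \<in> V" "y \<in> V" for s x y
    using transition_double[OF K, of s "\<pi> x" "\<pi> y"] that \<pi>V
      sum.reindex_bij_betw[OF \<pi>, of "\<lambda>z. K s (\<pi> x) z * K s z (\<pi> y)"]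
    by simp
  show ?thesis
    using t xy fin Q gen col add \<pi>V
      transition_nonneg[OF K] transition_sum[OF K] transition_double[OF K]
    by (intro semigroup_eqI[where A = K and B = "\<lambda>t x y. K t (\<pi> x) (\<pi> y)" and V = V and Q = Q])
      simp_all
qed

text \<open>To first order K_h - K'_h is h (Q - Q'), but the o(h) remainder can destroy positivity
  in directions where the form of Q - Q' vanishes. The factor \<open>exp (\<epsilon> * h)\<close>
  adds about \<open>\<epsilon> * h\<close> times the identity, which absorbs the remainder; finally
  \<open>\<epsilon>\<close> tends to 0.\<close>

lemma trace_transition_mono:
  assumes fin: "finite V"
    and K: "transition_function V K" and Q: "has_generator V K Q"
    and sym: "\<And>x y. x \<in> V \<Longrightarrow> y \<in> V \<Longrightarrow> Q x y = Q y x"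
    and K': "transition_function V K'" and Q': "has_generator V K' Q'"
    and sym': "\<And>x y. x \<in> V \<Longrightarrow> y \<in> V \<Longrightarrow> Q' x y = Q' y x"
    and psd: "\<And>f. 0 \<le> (\<Sum>x\<in>V. \<Sum>y\<in>V. (Q x y - Q' x y) * (f x * f y))"
    and t: "0 < t"
  shows "(\<Sum>x\<in>V. K' t x x) \<le> (\<Sum>x\<in>V. K t x x)"
proof -
  have R: "symmetric_semigroup V K'"
    using transition_symmetric[OF fin K' Q' sym'] transition_add[OF K']
    unfolding symmetric_semigroup_def by blast
  have main: "(\<Sum>x\<in>V. K' t x x) \<le> exp (\<epsilon> * t) * (\<Sum>x\<in>V. K t x x)" if \<epsilon>: "0 < \<epsilon>" for \<epsilon>
  proof -
    define P where "P s x y = exp (\<epsilon> * s) * K s x y" for s x y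
    have P: "symmetric_semigroup V P"
      using transition_symmetric[OF fin K Q sym] transition_add[OF K]
      unfolding symmetric_semigroup_def P_def
      by (auto simp: sum_distrib_left distrib_left exp_add mult_ac)
    \<comment> \<open>An entrywise error \<open>\<delta>\<close> changes the quadratic form by at
      most \<open>\<delta> * card V\<close> times the squared norm of \<open>f\<close>, which must
      not exceed the gain \<open>\<epsilon>\<close>. Adding 1 keeps \<open>\<delta>\<close> positive
      even for empty \<open>V\<close>.\<close>
    define \<delta> where "\<delta> = \<epsilon> / (real (card V) + 1)"
    have \<delta>: "0 < \<delta>" "\<delta> * real (card V) \<le> \<epsilon>"
      using \<epsilon> by (auto simp: \<delta>_def divide_simps)
    \<comment> \<open>The derivative of P_h - K'_h at h = 0.\<close>
    define L where "L x y = Q x y - Q' x y + \<epsilon> * of_bool (x = y)" for x y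
    have "((\<lambda>h. (P h x y - K' h x y) / h) \<longlongrightarrow> L x y) (at_right 0)" if xy: "x \<in> V" "y \<in> V" for x y
    proof -
      have e1: "((\<lambda>h. exp (\<epsilon> * h)) \<longlongrightarrow> 1) (at_right 0)"
        by real_asymp
      have e2: "((\<lambda>h. (exp (\<epsilon> * h) - 1) / h) \<longlongrightarrow> \<epsilon>) (at_right 0)"
        by real_asymp
      have "((\<lambda>h. exp (\<epsilon> * h) * ((K h x y - of_bool (x = y)) / h)
            - (K' h x y - of_bool (x = y)) / h + (exp (\<epsilon> * h) - 1) / h * of_bool (x = y))
          \<longlongrightarrow> 1 * Q x y - Q' x y + \<epsilon> * of_bool (x = y)) (at_right 0)"
        using Q Q' xy unfolding has_generator_def by (intro tendsto_intros e1 e2) auto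
      moreover have "exp (\<epsilon> * h) * ((K h x y - of_bool (x = y)) / h)
            - (K' h x y - of_bool (x = y)) / h + (exp (\<epsilon> * h) - 1) / h * of_bool (x = y)
          = (P h x y - K' h x y) / h" for h
        by (simp add: P_def diff_divide_distrib algebra_simps)
      ultimately show ?thesis
        by (simp add: L_def)
    qed
    then have "\<forall>\<^sub>F h in at_right 0. \<bar>(P h x y - K' h x y) / h - L x y\<bar> < \<delta>"
      if "x \<in> V" "y \<in> V" for x y
      using \<delta>(1) that by (fastforce dest: tendstoD[where e = \<delta>] simp: dist_real_def)
    then have "\<forall>\<^sub>F h in at_right 0. \<forall>x\<in>V. \<forall>y\<in>V. \<bar>(P h x y - K' h x y) / h - L x y\<bar> < \<delta>"
      using fin by (simp add: eventually_ball_finite)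
    then have "\<forall>\<^sub>F h in at_right 0. \<forall>f. 0 \<le> (\<Sum>x\<in>V. \<Sum>y\<in>V. (P h x y - K' h x y) * (f x * f y))"
      using eventually_at_right_less[of "0::real"]
    proof eventually_elim
      case (elim h)
      show ?case
      proof
        fix f :: "'a \<Rightarrow> real"
        define N where "N = (\<Sum>x\<in>V. (f x)\<^sup>2)"
        have sum1: "(\<Sum>x\<in>V. \<Sum>y\<in>V. ((f x)\<^sup>2 + (f y)\<^sup>2) / 2) = real (card V) * N"
          by (simp add: N_def sum.distrib add_divide_distrib sum_divide_distrib[symmetric]
              sum_distrib_left[symmetric])
        have "(\<Sum>x\<in>V. \<Sum>y\<in>V. L x y * (f x * f y))
            = (\<Sum>x\<in>V. \<Sum>y\<in>V. (Q x y - Q' x y) * (f x * f y))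
              + (\<Sum>x\<in>V. \<Sum>y\<in>V. if y = x then \<epsilon> * (f x)\<^sup>2 else 0)"
          unfolding sum.distrib[symmetric] L_def
          by (intro sum.cong refl) (auto simp: algebra_simps power2_eq_square)
        also have "(\<Sum>x\<in>V. \<Sum>y\<in>V. if y = x then \<epsilon> * (f x)\<^sup>2 else 0) = \<epsilon> * N"
          using fin by (simp add: N_def sum_distrib_left)
        finally have 1: "\<epsilon> * N \<le> (\<Sum>x\<in>V. \<Sum>y\<in>V. L x y * (f x * f y))"
          using psd[of f] by simp
        have "(L x y - (P h x y - K' h x y) / h) * (f x * f y) \<le> \<delta> * (((f x)\<^sup>2 + (f y)\<^sup>2) / 2)"
          if xy: "x \<in> V" "y \<in> V" for x y
        proof -
          have "(L x y - (P h x y - K' h x y) / h) * (f x * f y)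
              \<le> \<bar>L x y - (P h x y - K' h x y) / h\<bar> * \<bar>f x * f y\<bar>"
            by (metis abs_ge_self abs_mult)
          also have "\<dots> \<le> \<delta> * \<bar>f x * f y\<bar>"
            using elim(1) xy by (intro mult_right_mono) (auto simp: abs_minus_commute less_imp_le)
          also have "\<bar>f x * f y\<bar> \<le> ((f x)\<^sup>2 + (f y)\<^sup>2) / 2"
            using sum_squares_bound[of "\<bar>f x\<bar>" "\<bar>f y\<bar>"] by (simp add: abs_mult)
          finally show ?thesis
            using \<delta>(1) by simp
        qed
        then have "(\<Sum>x\<in>V. \<Sum>y\<in>V. (L x y - (P h x y - K' h x y) / h) * (f x * f y))
            \<le> (\<Sum>x\<in>V. \<Sum>y\<in>V. \<delta> * (((f x)\<^sup>2 + (f y)\<^sup>2) / 2))"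
          by (intro sum_mono)
        also have "\<dots> = \<delta> * real (card V) * N"
          unfolding sum_distrib_left[symmetric] sum1 by simp
        also have "\<dots> \<le> \<epsilon> * N"
          using \<delta>(2) by (intro mult_right_mono) (auto simp: N_def sum_nonneg)
        finally have "0 \<le> (\<Sum>x\<in>V. \<Sum>y\<in>V. (P h x y - K' h x y) / h * (f x * f y))"
          using 1 by (simp add: sum_subtractf left_diff_distrib)
        also have "\<dots> = (\<Sum>x\<in>V. \<Sum>y\<in>V. (P h x y - K' h x y) * (f x * f y)) / h"
          by (simp add: sum_divide_distrib)
        finally show "0 \<le> (\<Sum>x\<in>V. \<Sum>y\<in>V. (P h x y - K' h x y) * (f x * f y))"
          using elim(2) by (simp add: zero_le_divide_iff)
      qed
    qed
    from trace_mono_semigroup[OF P R fin _ t this]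
    show ?thesis
      using transition_zero[OF K'] by (simp add: P_def sum_distrib_left)
  qed
  have "((\<lambda>\<epsilon>. exp (\<epsilon> * t) * (\<Sum>x\<in>V. K t x x)) \<longlongrightarrow> exp (0 * t) * (\<Sum>x\<in>V. K t x x)) (at_right 0)"
    by (intro tendsto_intros)
  moreover have "\<forall>\<^sub>F \<epsilon> in at_right 0. (\<Sum>x\<in>V. K' t x x) \<le> exp (\<epsilon> * t) * (\<Sum>x\<in>V. K t x x)"
    using eventually_at_right_less[of "0::real"] by eventually_elim (rule main)
  ultimately show ?thesis
    using tendsto_lowerbound[OF _ _ trivial_limit_at_right_real] by fastforce
qed

section \<open>Distances to the uniform distribution\<close>

text \<open>The Markov property at the two times 0 < t gives the joint law of \<open>X 0\<close> and
  \<open>X t\<close>. As \<open>X 0\<close> is almost surely \<open>x0\<close>, this is already the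
  law of \<open>X t\<close>, with the same \<open>K\<close> for every \<open>t\<close>.\<close>

lemma ctmc_law:
  assumes "ctmc V Q x0 M X" and x0: "x0 \<in> V"
  obtains K where "transition_function V K" "has_generator V K Q"
    "\<And>t v. 0 < t \<Longrightarrow> v \<in> V \<Longrightarrow> law V M (X t) v = K t x0 v"
proof -
  interpret prob_space M
    using assms(1) by (simp add: ctmc_def)
  have meas: "X t \<in> measurable M (count_space V)" if "0 \<le> t" for t
    using assms(1) that by (simp add: ctmc_def)
  have init: "AE \<omega> in M. X 0 \<omega> = x0"
    using assms(1) by (simp add: ctmc_def)
  obtain K where K: "transition_function V K" "has_generator V K Q"
    and markov: "\<And>(n::nat) (t :: nat \<Rightarrow> real) x. 0 \<le> t 0 \<Longrightarrow> (\<forall>i\<le>n. t i < t (Suc i)) \<Longrightarrow>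
          (\<forall>i\<le>Suc n. x i \<in> V) \<Longrightarrow>
          measure M {\<omega> \<in> space M. \<forall>i\<le>Suc n. X (t i) \<omega> = x i} =
          measure M {\<omega> \<in> space M. \<forall>i\<le>n. X (t i) \<omega> = x i} *
            K (t (Suc n) - t n) (x n) (x (Suc n))"
    using assms(1) unfolding ctmc_def by blast
  have "law V M (X t) v = K t x0 v" if t: "0 < t" and v: "v \<in> V" for t v
  proof -
    have [measurable]: "X t \<in> measurable M (count_space V)" "X 0 \<in> measurable M (count_space V)"
      using meas t by auto
    have ev [measurable]: "{\<omega> \<in> space M. X s \<omega> = u} \<in> sets M" if "0 \<le> s" "u \<in> V" for s u
    proof -
      have "{\<omega> \<in> space M. X s \<omega> = u} = X s -` {u} \<inter> space M"
        by auto
      then show ?thesis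
        using measurable_sets[OF meas[OF that(1)], of "{u}"] that(2) by simp
    qed
    have "law V M (X t) v = measure M {\<omega> \<in> space M. X t \<omega> = v}"
      unfolding law_def using v
      by (subst measure_distr) (auto intro!: arg_cong[where f = "measure M"])
    also have "\<dots> = measure M ({\<omega> \<in> space M. X 0 \<omega> = x0} \<inter> {\<omega> \<in> space M. X t \<omega> = v})"
      using ev[of t v] ev[of 0 x0] t v x0 init by (intro finite_measure_eq_AE) auto
    also have "\<dots> = measure M {\<omega> \<in> space M. X 0 \<omega> = x0} * K t x0 v"
    proof -
      \<comment> \<open>The instance n = 0 has the two indices 0 and \<open>Suc 0\<close>.\<close>
      have "{\<omega> \<in> space M. X 0 \<omega> = x0} \<inter> {\<omega> \<in> space M. X t \<omega> = v}
          = {\<omega> \<in> space M. \<forall>i\<le>Suc 0. X (if i = 0 then 0 else t) \<omega> = (if i = 0 then x0 else v)}"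
        by (auto simp: le_Suc_eq)
      then show ?thesis
        using markov[of "\<lambda>i. if i = 0 then 0 else t" 0 "\<lambda>i. if i = 0 then x0 else v"] t v x0
        by simp
    qed
    also have "measure M {\<omega> \<in> space M. X 0 \<omega> = x0} = 1"
      using init ev[of 0 x0] x0 by (simp add: prob_Collect_eq_1)
    finally show ?thesis by simp
  qed
  with K show thesis by (rule that)
qed

lemma sum_centered_product:
  fixes a b :: "'a \<Rightarrow> real"
  assumes "finite V" "V \<noteq> {}" "(\<Sum>z\<in>V. a z) = 1" "(\<Sum>z\<in>V. b z) = 1"
  shows "(\<Sum>z\<in>V. (a z - 1 / card V) * (b z - 1 / card V)) = (\<Sum>z\<in>V. a z * b z) - 1 / card V"
proof -
  have "(\<Sum>z\<in>V. (a z - 1 / card V) * (b z - 1 / card V))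
      = (\<Sum>z\<in>V. a z * b z) - (\<Sum>z\<in>V. a z) / card V - (\<Sum>z\<in>V. b z) / card V
        + card V * (1 / card V * (1 / card V))"
    by (simp add: algebra_simps sum.distrib sum_subtractf sum_divide_distrib)
  then show ?thesis
    using assms by simp
qed

text \<open>By symmetry the sum of squares of row \<open>e\<close> of K_t is the return probability
  at time 2t; centring subtracts 1 / card V.\<close>

lemma l2_dist_uniform:
  assumes fin: "finite V" and K: "transition_function V K" and P: "symmetric_semigroup V K"
    and t: "0 \<le> t" and e: "e \<in> V"
    and f: "\<And>v. v \<in> V \<Longrightarrow> f v = K t e v"
  shows "l2_dist V f (pmf (pmf_of_set V)) = sqrt (K (2 * t) e e - 1 / card V)"
proof -
  have ne: "V \<noteq> {}" using e by auto
  have "(\<Sum>v\<in>V. \<bar>f v - pmf (pmf_of_set V) v\<bar>\<^sup>2)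
      = (\<Sum>v\<in>V. (K t e v - 1 / card V) * (K t e v - 1 / card V))"
    using f fin ne by (intro sum.cong) (simp_all add: power2_eq_square)
  also have "\<dots> = (\<Sum>v\<in>V. K t e v * K t e v) - 1 / card V"
    using transition_sum[OF K t e] by (intro sum_centered_product fin ne)
  also have "(\<Sum>v\<in>V. K t e v * K t e v) = K (2 * t) e e"
    using symmetric_semigroup_square[OF P t e e] symmetric_semigroup_sym[OF P t e] by simp
  finally show ?thesis
    by (simp add: l2_dist_def)
qed

text \<open>The matrix K_t - 1 / card V is the Gram matrix of the centred rows \<open>D u\<close> of
  K_(t/2). These have equal norms because the diagonal of K_t is constant, so no entry exceeds the
  diagonal one in absolute value.\<close>

lemma linf_dist_uniform:
  assumes fin: "finite V" and K: "transition_function V K" and P: "symmetric_semigroup V K"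
    and t: "0 \<le> t" and e: "e \<in> V" and diag: "\<And>v. v \<in> V \<Longrightarrow> K t v v = K t e e"
    and f: "\<And>v. v \<in> V \<Longrightarrow> f v = K t e v"
  shows "linf_dist V f (pmf (pmf_of_set V)) = K t e e - 1 / card V"
proof -
  have ne: "V \<noteq> {}" using e by auto
  have t2: "0 \<le> t / 2" using t by simp
  define D where "D u z = K (t / 2) u z - 1 / card V" for u z
  have inner: "(\<Sum>z\<in>V. D u z * D v z) = K t u v - 1 / card V" if uv: "u \<in> V" "v \<in> V" for u v
  proof -
    have "(\<Sum>z\<in>V. D u z * D v z) = (\<Sum>z\<in>V. K (t / 2) u z * K (t / 2) v z) - 1 / card V"
      unfolding D_def using transition_sum[OF K t2] uv by (intro sum_centered_product fin ne) auto
    also have "(\<Sum>z\<in>V. K (t / 2) u z * K (t / 2) v z) = K t u v"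
      using symmetric_semigroup_square[OF P t2 uv] symmetric_semigroup_sym[OF P t2] uv by simp
    finally show ?thesis .
  qed
  have bound: "\<bar>K t e v - 1 / card V\<bar> \<le> K t e e - 1 / card V" if v: "v \<in> V" for v
  proof -
    have "\<bar>K t e v - 1 / card V\<bar> \<le> (\<Sum>z\<in>V. \<bar>D e z * D v z\<bar>)"
      unfolding inner[OF e v, symmetric] by (rule sum_abs)
    also have "\<dots> \<le> (\<Sum>z\<in>V. (D e z * D e z + D v z * D v z) / 2)"
    proof (rule sum_mono)
      fix z
      show "\<bar>D e z * D v z\<bar> \<le> (D e z * D e z + D v z * D v z) / 2"
        using sum_squares_bound[of "\<bar>D e z\<bar>" "\<bar>D v z\<bar>"] by (simp add: abs_mult power2_eq_square)
    qed
    also have "\<dots> = K t e e - 1 / card V"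
      using inner[OF e e] inner[OF v v] diag[OF v]
      by (simp add: sum_divide_distrib[symmetric] sum.distrib)
    finally show ?thesis .
  qed
  have val: "\<bar>f v - pmf (pmf_of_set V) v\<bar> = \<bar>K t e v - 1 / card V\<bar>" if "v \<in> V" for v
    using that f fin ne by simp
  have "(\<lambda>v. \<bar>f v - pmf (pmf_of_set V) v\<bar>) ` V = (\<lambda>v. \<bar>K t e v - 1 / card V\<bar>) ` V"
    using val by (intro image_cong) auto
  moreover have "Max ((\<lambda>v. \<bar>K t e v - 1 / card V\<bar>) ` V) = K t e e - 1 / card V"
  proof (rule Max_eqI)
    show "K t e e - 1 / card V \<in> (\<lambda>v. \<bar>K t e v - 1 / card V\<bar>) ` V"
      using bound[OF e] e by (intro image_eqI[of _ _ e]) auto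
  qed (use fin bound in auto)
  ultimately show ?thesis
    by (simp add: linf_dist_def)
qed

section \<open>The generator of the random walk\<close>

text \<open>Inversion permutes \<open>S\<close> and preserves the rates, and y = x s exactly when x
  = y s^(-1).\<close>

lemma walk_generator_symmetric:
  fixes G (structure)
  assumes G: "group G" and S: "symmetric_generating_set G S" and r: "symmetric_rates G S r"
    and xy: "x \<in> carrier G" "y \<in> carrier G"
  shows "walk_generator G S r x y = walk_generator G S r y x"
proof -
  interpret group G by fact
  have SG: "S \<subseteq> carrier G" and inv: "\<And>s. s \<in> S \<Longrightarrow> inv s \<in> S"
    using S by (auto simp: symmetric_generating_set_def)
  have r: "\<And>s. s \<in> S \<Longrightarrow> r (inv s) = r s"
    using r by (simp add: symmetric_rates_def)
  show ?thesis
    unfolding walk_generator_def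
  proof (rule sum.reindex_bij_witness[of _ "\<lambda>s. inv s" "\<lambda>s. inv s"])
    fix s assume s: "s \<in> S"
    then have sG: "s \<in> carrier G" using SG by auto
    then have "x = y \<otimes> inv s \<longleftrightarrow> y = x \<otimes> s"
      using xy by (metis inv_solve_right)
    then show "r (inv s) * (of_bool (x = y \<otimes> inv s) - of_bool (x = y))
        = r s * (of_bool (y = x \<otimes> s) - of_bool (y = x))"
      using r[OF s] by (auto simp: eq_commute)
  qed (use SG inv in auto)
qed

lemma walk_generator_left_invariant:
  fixes G (structure)
  assumes "group G" and "S \<subseteq> carrier G"
    and "g \<in> carrier G" "x \<in> carrier G" "y \<in> carrier G"
  shows "walk_generator G S r (g \<otimes> x) (g \<otimes> y) = walk_generator G S r x y"
proof -
  interpret group G by fact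
  show ?thesis
    unfolding walk_generator_def
  proof (intro sum.cong refl)
    fix s assume "s \<in> S"
    then have "s \<in> carrier G" using assms by auto
    then show "r s * (of_bool (g \<otimes> y = g \<otimes> x \<otimes> s) - of_bool (g \<otimes> y = g \<otimes> x))
        = r s * (of_bool (y = x \<otimes> s) - of_bool (y = x))"
      using assms by (simp add: m_assoc)
  qed
qed

lemma walk_generator_diff:
  "walk_generator G S r x y - walk_generator G S r' x y = walk_generator G S (\<lambda>s. r s - r' s) x y"
  by (simp add: walk_generator_def sum_subtractf[symmetric] algebra_simps)

text \<open>Applied to the rate differences r - r'. Right translation by \<open>s\<close> permutes
  the group, so each \<open>s\<close> contributes -r_s / 2 times the sum of (f(x) - f(x s))^2, a
  Dirichlet form.\<close>

lemma walk_generator_nonpos_rates_psd: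
  fixes G (structure)
  assumes G: "group G" and fin: "finite (carrier G)" and SG: "S \<subseteq> carrier G"
    and r: "\<And>s. s \<in> S \<Longrightarrow> r s \<le> 0"
  shows "0 \<le> (\<Sum>x\<in>carrier G. \<Sum>y\<in>carrier G. walk_generator G S r x y * (f x * f y))"
proof -
  interpret group G by fact
  let ?V = "carrier G"
  have row: "(\<Sum>y\<in>?V. walk_generator G S r x y * (f x * f y))
      = (\<Sum>s\<in>S. r s * (f x * f (x \<otimes> s) - f x * f x))" if x: "x \<in> ?V" for x
  proof -
    have "(\<Sum>y\<in>?V. walk_generator G S r x y * (f x * f y))
        = (\<Sum>y\<in>?V. \<Sum>s\<in>S. r s * ((if y = x \<otimes> s then f x * f y else 0) - (if y = x then f x * f y else 0)))"
      unfolding walk_generator_def sum_distrib_right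
      by (intro sum.cong refl) (auto simp: algebra_simps)
    also have "\<dots> = (\<Sum>s\<in>S. \<Sum>y\<in>?V. r s * ((if y = x \<otimes> s then f x * f y else 0) - (if y = x then f x * f y else 0)))"
      by (rule sum.swap)
    also have "\<dots> = (\<Sum>s\<in>S. r s * (f x * f (x \<otimes> s) - f x * f x))"
      using x SG fin
      by (intro sum.cong refl) (auto simp: sum_distrib_left[symmetric] sum_subtractf subset_eq)
    finally show ?thesis .
  qed
  have "(\<Sum>x\<in>?V. \<Sum>y\<in>?V. walk_generator G S r x y * (f x * f y))
      = (\<Sum>x\<in>?V. \<Sum>s\<in>S. r s * (f x * f (x \<otimes> s) - f x * f x))"
    using row by simp
  also have "\<dots> = (\<Sum>s\<in>S. r s * (\<Sum>x\<in>?V. f x * f (x \<otimes> s) - f x * f x))"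
    by (subst sum.swap) (simp add: sum_distrib_left)
  also have "\<dots> \<ge> 0"
  proof (intro sum_nonneg mult_nonpos_nonpos r)
    fix s assume "s \<in> S"
    then have s: "s \<in> ?V" using SG by auto
    have "bij_betw (\<lambda>x. x \<otimes> s) ?V ?V"
      using s by (intro bij_betw_byWitness[of _ "\<lambda>x. x \<otimes> inv s"]) (auto simp: m_assoc)
    then have shift: "(\<Sum>x\<in>?V. f (x \<otimes> s) * f (x \<otimes> s)) = (\<Sum>x\<in>?V. f x * f x)"
      by (rule sum.reindex_bij_betw)
    have "(\<Sum>x\<in>?V. f x * f (x \<otimes> s)) \<le> (\<Sum>x\<in>?V. (f x * f x + f (x \<otimes> s) * f (x \<otimes> s)) / 2)"
      using sum_squares_bound[of "f x" "f (x \<otimes> s)" for x]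
      by (intro sum_mono) (simp add: power2_eq_square mult_ac)
    also have "\<dots> = (\<Sum>x\<in>?V. f x * f x)"
      by (simp add: sum_divide_distrib[symmetric] sum.distrib shift)
    finally show "(\<Sum>x\<in>?V. f x * f (x \<otimes> s) - f x * f x) \<le> 0"
      by (simp add: sum_subtractf)
  qed
  finally show ?thesis .
qed

lemma walk_transition:
  fixes G (structure)
  assumes G: "group G" and fin: "finite (carrier G)"
    and S: "symmetric_generating_set G S" and r: "symmetric_rates G S r"
    and K: "transition_function (carrier G) K"
    and Q: "has_generator (carrier G) K (walk_generator G S r)"
  shows walk_transition_symmetric_semigroup: "symmetric_semigroup (carrier G) K"
    and walk_transition_diag:
      "0 < t \<Longrightarrow> x \<in> carrier G \<Longrightarrow> K t x x = K t \<one> \<one>"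
proof -
  interpret group G by fact
  note sym = walk_generator_symmetric[OF G S r]
  show "symmetric_semigroup (carrier G) K"
    using transition_symmetric[OF fin K Q sym] transition_add[OF K]
    unfolding symmetric_semigroup_def by blast
  assume t: "0 < t" and x: "x \<in> carrier G"
  have "bij_betw (\<lambda>y. x \<otimes> y) (carrier G) (carrier G)"
    using x by (intro bij_betw_byWitness[of _ "\<lambda>y. inv x \<otimes> y"]) (auto simp: m_assoc[symmetric])
  moreover have "S \<subseteq> carrier G"
    using S by (simp add: symmetric_generating_set_def)
  \<comment> \<open>Left translation by \<open>x\<close> preserves the generator, because jumps
    multiply on the right, and carries the identity to \<open>x\<close>.\<close>
  ultimately have "K t \<one> \<one> = K t (x \<otimes> \<one>) (x \<otimes> \<one>)"
    using x t by (intro transition_invariant[OF fin K Q sym]) (auto intro!: walk_generator_left_invariant G)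
  then show "K t x x = K t \<one> \<one>"
    using x by simp
qed

theorem proposition3p12:
  fixes G :: "('a, 'b) monoid_scheme" and S :: "'a set"
    and r r' :: "'a \<Rightarrow> real" and t :: real
    and M :: "'v measure" and X :: "real \<Rightarrow> 'v \<Rightarrow> 'a"
    and M' :: "'w measure" and X' :: "real \<Rightarrow> 'w \<Rightarrow> 'a"
  assumes "group G" and "finite (carrier G)"
    and "symmetric_generating_set G S"
    and "symmetric_rates G S r" and "symmetric_rates G S r'"
    and "\<And>s. s \<in> S \<Longrightarrow> r s \<le> r' s"
    and "random_walk G S r M X" and "random_walk G S r' M' X'"
    and "t > 0"
  shows "linf_dist (carrier G) (law (carrier G) M' (X' t)) (pmf (pmf_of_set (carrier G)))
           \<le> linf_dist (carrier G) (law (carrier G) M (X t)) (pmf (pmf_of_set (carrier G)))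
       \<and> l2_dist (carrier G) (law (carrier G) M' (X' t)) (pmf (pmf_of_set (carrier G)))
           \<le> l2_dist (carrier G) (law (carrier G) M (X t)) (pmf (pmf_of_set (carrier G)))"
proof -
  interpret group G by fact
  let ?V = "carrier G" and ?e = "\<one>\<^bsub>G\<^esub>"
  note fin = assms(2) and S = assms(3) and t = assms(9)
  have SG: "S \<subseteq> ?V"
    using S by (simp add: symmetric_generating_set_def)
  have one: "?e \<in> ?V" by simp
  obtain K where K: "transition_function ?V K" "has_generator ?V K (walk_generator G S r)"
    and law: "\<And>t v. 0 < t \<Longrightarrow> v \<in> ?V \<Longrightarrow> law ?V M (X t) v = K t ?e v"
    using assms(7) ctmc_law[OF _ one] unfolding random_walk_def by blast
  obtain K' where K': "transition_function ?V K'" "has_generator ?V K' (walk_generator G S r')"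
    and law': "\<And>t v. 0 < t \<Longrightarrow> v \<in> ?V \<Longrightarrow> law ?V M' (X' t) v = K' t ?e v"
    using assms(8) ctmc_law[OF _ one] unfolding random_walk_def by blast
  note P = walk_transition_symmetric_semigroup[OF assms(1) fin S assms(4) K]
  note P' = walk_transition_symmetric_semigroup[OF assms(1) fin S assms(5) K']
  note diag = walk_transition_diag[OF assms(1) fin S assms(4) K]
  note diag' = walk_transition_diag[OF assms(1) fin S assms(5) K']
  \<comment> \<open>Return probabilities are compared at every positive time: s = t serves the
    sup-distance and s = 2t the l2-distance. The diagonal is constant, so each trace is card G times
    the return probability.\<close>
  have mono: "K' s ?e ?e \<le> K s ?e ?e" if s: "0 < s" for s
  proof -
    have "0 \<le> (\<Sum>x\<in>?V. \<Sum>y\<in>?V.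
        (walk_generator G S r x y - walk_generator G S r' x y) * (f x * f y))" for f
      unfolding walk_generator_diff using assms(6) fin SG
      by (intro walk_generator_nonpos_rates_psd assms(1)) auto
    then have "(\<Sum>x\<in>?V. K' s x x) \<le> (\<Sum>x\<in>?V. K s x x)"
      using walk_generator_symmetric[OF assms(1) S] assms(4,5) s
      by (intro trace_transition_mono[OF fin K _ K']) auto
    moreover have "(\<Sum>x\<in>?V. K' s x x) = card ?V * K' s ?e ?e" "(\<Sum>x\<in>?V. K s x x) = card ?V * K s ?e ?e"
      using sum.cong[OF refl diag'[OF s], of ?V] sum.cong[OF refl diag[OF s], of ?V] by simp_all
    moreover have "0 < card ?V"
      using fin one card_gt_0_iff by blast
    ultimately show ?thesis by simp
  qed
  have "linf_dist ?V (law ?V M (X t)) (pmf (pmf_of_set ?V)) = K t ?e ?e - 1 / card ?V"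
    by (rule linf_dist_uniform[OF fin K(1) P less_imp_le[OF t] one diag[OF t] law[OF t]])
  moreover have "linf_dist ?V (law ?V M' (X' t)) (pmf (pmf_of_set ?V)) = K' t ?e ?e - 1 / card ?V"
    by (rule linf_dist_uniform[OF fin K'(1) P' less_imp_le[OF t] one diag'[OF t] law'[OF t]])
  moreover have "l2_dist ?V (law ?V M (X t)) (pmf (pmf_of_set ?V))
      = sqrt (K (2 * t) ?e ?e - 1 / card ?V)"
    by (rule l2_dist_uniform[OF fin K(1) P less_imp_le[OF t] one law[OF t]])
  moreover have "l2_dist ?V (law ?V M' (X' t)) (pmf (pmf_of_set ?V))
      = sqrt (K' (2 * t) ?e ?e - 1 / card ?V)"
    by (rule l2_dist_uniform[OF fin K'(1) P' less_imp_le[OF t] one law'[OF t]])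
  ultimately show ?thesis
    using mono[of t] mono[of "2 * t"] t by simp
qed

end
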